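(* Let $(X,d)$ be a compact, perfect metric space and let $\{X; f_1,\dots,f_N\}$ be an iterated function system consisting of contractions $f_i:X\to X$ that are infinitesimal similitudes on $X$, such that $(Df_i)(x)>0$ for every $x\in X$ and $i=1,\dots,N$. Let $A$ be the attractor of the system, i.e. the unique non-empty compact set with $A=\bigcup_{i=1}^N f_i(A)$. Then $$\dim_H(A)=\underline{\dim}_B(A)=\overline{\dim}_B(A).$$
   Context: For a map $f:(X,d_X)\to (Y,d_Y)$ between metric spaces and $x\in X$, let $(Df)^*(x)\subset\mathbb{R}$ be the set of all real limits $\lim_{n\to\infty} \frac{d_Y(f(x_n),f(y_n))}{d_X(x_n,y_n)}$, over sequences $(x_n),(y_n)$ in $X$ with $x_n\neq y_n$ for all $n$, $x_n\to x$, $y_n\to x$, for which the limit exists. $f$ is an infinitesimal similitude at $x$ if $(Df)^*(x)$ is a nonempty singleton; its element is then denoted $(Df)(x)$. $f$ is an infinitesimal similitude on $X$ if it is one at every $x\in X$. A contraction is a map $f:X\to X$ with $d(f(x),f(y))\le c\,d(x,y)$ for all $x,y$, for some $c<1$. $\dim_H$ is Hausdorff dimension. For a non-empty bounded set $F$, $N_\delta(F)$ is the smallest number of sets of diameter at most $\delta$ covering $F$; $\underline{\dim}_B(F)=\liminf_{\delta\to0^+}\frac{\log N_\delta(F)}{-\log\delta}$ and $\overline{\dim}_B(F)=\limsup_{\delta\to0^+}\frac{\log N_\delta(F)}{-\log\delta}$. *)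

theory Defs
  imports "HOL-Analysis.Analysis" "HOL-Library.Extended_Nat"
begin

(* A metric space (X,d) is a subset X of a type of class metric_space with the
   restricted metric; maps on X are total functions of which only the values on X matter. *)

definition deriv_limits ::
    "'a::metric_space set \<Rightarrow> ('a \<Rightarrow> 'b::metric_space) \<Rightarrow> 'a \<Rightarrow> real set" where
  "deriv_limits X f x =
     {L. \<exists>u v. (\<forall>n. u n \<in> X \<and> v n \<in> X \<and> u n \<noteq> v n) \<and>
               u \<longlonglongrightarrow> x \<and> v \<longlonglongrightarrow> x \<and>
               (\<lambda>n. dist (f (u n)) (f (v n)) / dist (u n) (v n)) \<longlonglongrightarrow> L}"

definition inf_similitude_at ::
    "'a::metric_space set \<Rightarrow> ('a \<Rightarrow> 'b::metric_space) \<Rightarrow> 'a \<Rightarrow> bool" where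
  "inf_similitude_at X f x \<longleftrightarrow> is_singleton (deriv_limits X f x)"

(* Meaningful only if f is an infinitesimal similitude at x. *)
definition inf_deriv ::
    "'a::metric_space set \<Rightarrow> ('a \<Rightarrow> 'b::metric_space) \<Rightarrow> 'a \<Rightarrow> real" where
  "inf_deriv X f x = the_elem (deriv_limits X f x)"

definition inf_similitude_on ::
    "'a::metric_space set \<Rightarrow> ('a \<Rightarrow> 'b::metric_space) \<Rightarrow> bool" where
  "inf_similitude_on X f \<longleftrightarrow> (\<forall>x\<in>X. inf_similitude_at X f x)"

definition contraction_on :: "'a::metric_space set \<Rightarrow> ('a \<Rightarrow> 'a) \<Rightarrow> bool" where
  "contraction_on X f \<longleftrightarrow>
     f ` X \<subseteq> X \<and> (\<exists>c<1. \<forall>x\<in>X. \<forall>y\<in>X. dist (f x) (f y) \<le> c * dist x y)"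

(* For contractions of a compact X, the Hutchinson fixed point theorem says that at most
   one set A satisfies this, so uniqueness is not repeated in the definition. *)
definition is_attractor ::
    "'a::metric_space set \<Rightarrow> nat \<Rightarrow> (nat \<Rightarrow> 'a \<Rightarrow> 'a) \<Rightarrow> 'a set \<Rightarrow> bool" where
  "is_attractor X N f A \<longleftrightarrow>
     A \<subseteq> X \<and> A \<noteq> {} \<and> compact A \<and> A = (\<Union>i\<in>{1..N}. f i ` A)"

(* The library's diameter is only meaningful for bounded sets, whence the boundedness
   condition here. *)
definition diam_le :: "'a::metric_space set \<Rightarrow> real \<Rightarrow> bool" where
  "diam_le U \<delta> \<longleftrightarrow> bounded U \<and> diameter U \<le> \<delta>"

(* diam(U)^s with the convention 0^0 = 1 for non-empty U, so that the 0-dimensional measure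
   is counting measure; note that 0 powr 0 = 0 in HOL. *)
definition diam_pow :: "real \<Rightarrow> 'a::metric_space set \<Rightarrow> real" where
  "diam_pow s U = (if U = {} then 0 else if s = 0 then 1 else diameter U powr s)"

definition hausdorff_premeasure ::
    "real \<Rightarrow> real \<Rightarrow> 'a::metric_space set \<Rightarrow> ennreal" where
  "hausdorff_premeasure s \<delta> F =
     (INF U \<in> {U :: nat \<Rightarrow> 'a set. F \<subseteq> (\<Union>n. U n) \<and> (\<forall>n. diam_le (U n) \<delta>)}.
        (\<Sum>n. ennreal (diam_pow s (U n))))"

(* The premeasure increases as \<delta> decreases, so the limit as \<delta> tends to 0 is a supremum. *)
definition hausdorff_measure :: "real \<Rightarrow> 'a::metric_space set \<Rightarrow> ennreal" where
  "hausdorff_measure s F = (SUP \<delta>\<in>{0<..}. hausdorff_premeasure s \<delta> F)"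

definition hausdorff_dim :: "'a::metric_space set \<Rightarrow> ereal" where
  "hausdorff_dim F = Inf (ereal ` {s. 0 \<le> s \<and> hausdorff_measure s F = 0})"

(* The infimum of the empty set is \<infinity>; this occurs only if F is not totally bounded or \<delta> is not positive. *)
definition covering_number :: "real \<Rightarrow> 'a::metric_space set \<Rightarrow> enat" where
  "covering_number \<delta> F =
     (INF C \<in> {C :: 'a set set. finite C \<and> F \<subseteq> \<Union>C \<and> (\<forall>U\<in>C. diam_le U \<delta>)}. enat (card C))"

definition ln_enat :: "enat \<Rightarrow> ereal" where
  "ln_enat k = (case k of enat n \<Rightarrow> ereal (ln (real n)) | \<infinity> \<Rightarrow> \<infinity>)"

definition lower_box_dim :: "'a::metric_space set \<Rightarrow> ereal" where
  "lower_box_dim F =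
     Liminf (at_right 0) (\<lambda>\<delta>::real. ln_enat (covering_number \<delta> F) / ereal (- ln \<delta>))"

definition upper_box_dim :: "'a::metric_space set \<Rightarrow> ereal" where
  "upper_box_dim F =
     Limsup (at_right 0) (\<lambda>\<delta>::real. ln_enat (covering_number \<delta> F) / ereal (- ln \<delta>))"

end

theory Submission
  imports Defs
begin

text \<open>
  Every small ball centred on \<open>A\<close> of radius \<open>r\<close> contains an image of \<open>A\<close> under a composition of the
  \<open>f i\<close> whose local contraction is no stronger than \<open>r powr (1 + \<epsilon>)\<close> up to a constant: the ratios
  of each \<open>f i\<close> vary by a factor close to 1 on small sets, and the inner maps of a long composition
  have already made everything small. If \<open>s < t\<close> are below the upper box dimension, then some scale
  \<open>\<delta>\<close> admits more than \<open>\<delta> powr (- t)\<close> separated points of \<open>A\<close>, a fixed proportion of which lies in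
  one ball of fixed radius. Small copies at these points form a separated system of maps of a compact
  piece \<open>D\<close> of \<open>A\<close> into itself which are too many and too little contracting for \<open>D\<close> to have zero
  \<open>s\<close>-dimensional measure. This is Falconer's implicit method for quasi self-similar sets.
\<close>

section \<open>Local behaviour of infinitesimal similitudes\<close>

text \<open>Bridge from the pointwise hypothesis to uniform estimates, for pairs whose distances
  tend to 0. Compactness of \<open>X\<close> gives a limit point \<open>x\<close>, the Lipschitz
  bound keeps the quotients in \<open>{0..c}\<close>, and a limit of them must be the element of the
  singleton \<open>deriv_limits X f x\<close>.\<close>

lemma ratio_subseq_limit:
  fixes f :: "'a::metric_space \<Rightarrow> 'b::metric_space"
  assumes X: "compact X" and lip: "\<And>x y. x \<in> X \<Longrightarrow> y \<in> X \<Longrightarrow> dist (f x) (f y) \<le> c * dist x y"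
    and sim: "inf_similitude_on X f"
    and uv: "\<And>n. u n \<in> X" "\<And>n. v n \<in> X" "\<And>n. u n \<noteq> v n"
    and d0: "(\<lambda>n. dist (u n) (v n)) \<longlonglongrightarrow> 0"
  obtains x r where "x \<in> X" "strict_mono (r :: nat \<Rightarrow> nat)" "(u \<circ> r) \<longlonglongrightarrow> x"
    "(\<lambda>n. dist (f (u (r n))) (f (v (r n))) / dist (u (r n)) (v (r n))) \<longlonglongrightarrow> inf_deriv X f x"
proof -
  obtain x r1 where x: "x \<in> X" and r1: "strict_mono (r1 :: nat \<Rightarrow> nat)" and ux: "(u \<circ> r1) \<longlonglongrightarrow> x"
    using X uv(1) unfolding compact_def by blast
  define q where "q n = dist (f (u n)) (f (v n)) / dist (u n) (v n)" for n
  have "q (r1 n) \<in> {0..c}" for n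
    using lip[OF uv(1,2), of "r1 n" "r1 n"] uv(3)[of "r1 n"] by (simp add: q_def divide_le_eq)
  then have "\<forall>n. (q \<circ> r1) n \<in> {0..c}" by simp
  moreover have "seq_compact {0..c}" using compact_Icc compact_imp_seq_compact by blast
  ultimately obtain L r2 where r2: "strict_mono (r2 :: nat \<Rightarrow> nat)" and L: "(q \<circ> r1 \<circ> r2) \<longlonglongrightarrow> L"
    unfolding seq_compact_def by blast
  define r where "r = r1 \<circ> r2"
  have r: "strict_mono r" using r1 r2 by (simp add: r_def strict_mono_o)
  have u: "(u \<circ> r) \<longlonglongrightarrow> x"
    using LIMSEQ_subseq_LIMSEQ[OF ux r2] by (simp add: r_def o_assoc)
  have d: "(\<lambda>n. dist (u (r n)) (v (r n))) \<longlonglongrightarrow> 0"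
    using LIMSEQ_subseq_LIMSEQ[OF d0 r] by (simp add: o_def)
  have v: "(v \<circ> r) \<longlonglongrightarrow> x"
  proof -
    have "(\<lambda>n. dist (u (r n)) x) \<longlonglongrightarrow> 0" using u tendsto_dist_iff[of "u \<circ> r" x] by (simp add: o_def)
    then have "(\<lambda>n. dist (u (r n)) (v (r n)) + dist (u (r n)) x) \<longlonglongrightarrow> 0"
      using tendsto_add[OF d] by fastforce
    then have "(\<lambda>n. dist (v (r n)) x) \<longlonglongrightarrow> 0"
      by (rule Lim_null_comparison[rotated]) (auto intro!: always_eventually simp: dist_triangle3)
    then show ?thesis using tendsto_dist_iff[of "v \<circ> r" x] by (simp add: o_def)
  qed
  have qL: "(\<lambda>n. q (r n)) \<longlonglongrightarrow> L" using L by (simp add: r_def o_def)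
  have "L \<in> deriv_limits X f x"
    unfolding deriv_limits_def mem_Collect_eq
    by (rule exI[of _ "u \<circ> r"], rule exI[of _ "v \<circ> r"]) (use u v qL uv in \<open>auto simp: q_def\<close>)
  moreover have "is_singleton (deriv_limits X f x)"
    using sim x by (simp add: inf_similitude_on_def inf_similitude_at_def)
  ultimately have "L = inf_deriv X f x"
    by (metis inf_deriv_def is_singleton_the_elem singletonD)
  then show thesis using that[OF x r u] qL by (simp add: q_def)
qed

text \<open>Otherwise pairs violating the bound for \<open>\<rho> = 1 / (n + 1)\<close> would
  produce a point with derivative 0. With one \<open>\<rho>\<close> as both scale and factor, the
  bound passes to smaller \<open>\<rho>\<close>; as an eventual statement it combines over finitely
  many maps.\<close>

lemma local_lower_bound:
  fixes f :: "'a::metric_space \<Rightarrow> 'b::metric_space"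
  assumes X: "compact X" and lip: "\<And>x y. x \<in> X \<Longrightarrow> y \<in> X \<Longrightarrow> dist (f x) (f y) \<le> c * dist x y"
    and sim: "inf_similitude_on X f" and pos: "\<And>x. x \<in> X \<Longrightarrow> 0 < inf_deriv X f x"
  shows "\<forall>\<^sub>F \<rho> in at_right 0. \<forall>u\<in>X. \<forall>v\<in>X. dist u v \<le> \<rho> \<longrightarrow> \<rho> * dist u v \<le> dist (f u) (f v)"
proof -
  have "\<exists>\<rho>>0. \<forall>u\<in>X. \<forall>v\<in>X. dist u v \<le> \<rho> \<longrightarrow> \<rho> * dist u v \<le> dist (f u) (f v)"
  proof (rule ccontr)
    assume "\<not> ?thesis"
    then have "\<forall>n. \<exists>u v. u \<in> X \<and> v \<in> X \<and> dist u v \<le> inverse (real (Suc n)) \<and>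
        dist (f u) (f v) < inverse (real (Suc n)) * dist u v"
      by (metis inverse_positive_iff_positive not_le of_nat_0_less_iff zero_less_Suc)
    then obtain u v where uv: "\<And>n. u n \<in> X" "\<And>n. v n \<in> X"
        "\<And>n. dist (u n) (v n) \<le> inverse (real (Suc n))"
        "\<And>n. dist (f (u n)) (f (v n)) < inverse (real (Suc n)) * dist (u n) (v n)"
      by metis
    have ne: "u n \<noteq> v n" for n using uv(4)[of n] by auto
    have inv0: "(\<lambda>n. inverse (real (Suc n))) \<longlonglongrightarrow> 0" by (rule LIMSEQ_inverse_real_of_nat)
    have d: "(\<lambda>n. dist (u n) (v n)) \<longlonglongrightarrow> 0"
      by (rule Lim_null_comparison[OF _ inv0]) (use uv in auto)
    obtain x r where x: "x \<in> X" and r: "strict_mono (r :: nat \<Rightarrow> nat)" and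
      lim: "(\<lambda>n. dist (f (u (r n))) (f (v (r n))) / dist (u (r n)) (v (r n))) \<longlonglongrightarrow> inf_deriv X f x"
      by (rule ratio_subseq_limit[OF X lip sim uv(1,2) ne d])
    have "(\<lambda>n. inverse (real (Suc (r n)))) \<longlonglongrightarrow> 0"
      using LIMSEQ_subseq_LIMSEQ[OF inv0 r] by (simp add: o_def)
    then have "(\<lambda>n. dist (f (u (r n))) (f (v (r n))) / dist (u (r n)) (v (r n))) \<longlonglongrightarrow> 0"
      by (rule Lim_null_comparison[rotated])
        (use uv(4) ne in \<open>auto intro!: always_eventually less_imp_le simp: pos_divide_less_eq\<close>)
    with lim have "inf_deriv X f x = 0" using LIMSEQ_unique by blast
    with pos[OF x] show False by simp
  qed
  then obtain \<rho> where \<rho>: "\<rho> > 0" "\<And>u v. u\<in>X \<Longrightarrow> v\<in>X \<Longrightarrow> dist u v \<le> \<rho> \<Longrightarrow> \<rho> * dist u v \<le> dist (f u) (f v)"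
    by blast
  show ?thesis
    unfolding eventually_at_right_field
  proof (intro exI[of _ \<rho>] conjI allI impI ballI)
    fix \<rho>' u v assume *: "0 < \<rho>'" "\<rho>' < \<rho>" "u \<in> X" "v \<in> X" "dist u v \<le> \<rho>'"
    then have "\<rho>' * dist u v \<le> \<rho> * dist u v" by (simp add: mult_right_mono)
    also have "\<dots> \<le> dist (f u) (f v)" using \<rho>(2) * by simp
    finally show "\<rho>' * dist u v \<le> dist (f u) (f v)" .
  qed (use \<rho> in auto)
qed

text \<open>Violating quadruples at scales tending to 0 accumulate at one point \<open>x\<close>,
  where both quotients tend to the same positive derivative, against \<open>1 < q\<close>. Products
  in place of quotients allow pairs of equal points.\<close>

lemma local_ratio_comparison:
  fixes f :: "'a::metric_space \<Rightarrow> 'b::metric_space"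
  assumes X: "compact X" and lip: "\<And>x y. x \<in> X \<Longrightarrow> y \<in> X \<Longrightarrow> dist (f x) (f y) \<le> c * dist x y"
    and sim: "inf_similitude_on X f" and pos: "\<And>x. x \<in> X \<Longrightarrow> 0 < inf_deriv X f x"
    and q: "1 < q"
  shows "\<forall>\<^sub>F \<rho> in at_right 0. \<forall>u\<in>X. \<forall>v\<in>X. \<forall>u'\<in>X. \<forall>v'\<in>X.
    dist u v \<le> \<rho> \<and> dist u u' \<le> \<rho> \<and> dist u' v' \<le> \<rho> \<longrightarrow>
    dist (f u') (f v') * dist u v \<le> q * (dist (f u) (f v) * dist u' v')"
proof -
  have "\<exists>\<rho>>0. \<forall>u\<in>X. \<forall>v\<in>X. \<forall>u'\<in>X. \<forall>v'\<in>X.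
    dist u v \<le> \<rho> \<and> dist u u' \<le> \<rho> \<and> dist u' v' \<le> \<rho> \<longrightarrow>
    dist (f u') (f v') * dist u v \<le> q * (dist (f u) (f v) * dist u' v')" (is "\<exists>\<rho>>0. ?P \<rho>")
  proof (rule ccontr)
    assume "\<not> ?thesis"
    then have "\<forall>n. \<not> ?P (inverse (real (Suc n)))"
      by (metis inverse_positive_iff_positive of_nat_0_less_iff zero_less_Suc)
    then have "\<forall>n. \<exists>u v u' v'. u \<in> X \<and> v \<in> X \<and> u' \<in> X \<and> v' \<in> X \<and>
        dist u v \<le> inverse (real (Suc n)) \<and> dist u u' \<le> inverse (real (Suc n)) \<and>
        dist u' v' \<le> inverse (real (Suc n)) \<and>
        q * (dist (f u) (f v) * dist u' v') < dist (f u') (f v') * dist u v"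
      unfolding Ball_def not_all not_imp not_le by blast
    then obtain u v u' v' where uv: "\<And>n. u n \<in> X" "\<And>n. v n \<in> X" "\<And>n. u' n \<in> X" "\<And>n. v' n \<in> X"
        "\<And>n. dist (u n) (v n) \<le> inverse (real (Suc n))"
        "\<And>n. dist (u n) (u' n) \<le> inverse (real (Suc n))"
        "\<And>n. dist (u' n) (v' n) \<le> inverse (real (Suc n))"
        "\<And>n. q * (dist (f (u n)) (f (v n)) * dist (u' n) (v' n)) < dist (f (u' n)) (f (v' n)) * dist (u n) (v n)"
      by metis
    \<comment> \<open>The strict inequality rules out equal points, for which both sides would
      vanish.\<close>
    have ne: "u n \<noteq> v n" "u' n \<noteq> v' n" for n using uv(8)[of n] by auto
    have inv0: "(\<lambda>n. inverse (real (Suc n))) \<longlonglongrightarrow> 0" by (rule LIMSEQ_inverse_real_of_nat)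
    have d: "(\<lambda>n. dist (u n) (v n)) \<longlonglongrightarrow> 0" "(\<lambda>n. dist (u n) (u' n)) \<longlonglongrightarrow> 0"
        "(\<lambda>n. dist (u' n) (v' n)) \<longlonglongrightarrow> 0"
      by (rule Lim_null_comparison[OF _ inv0]; use uv in auto)+
    obtain x r where x: "x \<in> X" and r: "strict_mono (r :: nat \<Rightarrow> nat)" and ux: "(u \<circ> r) \<longlonglongrightarrow> x" and
      lim: "(\<lambda>n. dist (f (u (r n))) (f (v (r n))) / dist (u (r n)) (v (r n))) \<longlonglongrightarrow> inf_deriv X f x"
      by (rule ratio_subseq_limit[OF X lip sim uv(1,2) ne(1) d(1)])
    have d3: "(\<lambda>n. dist (u' (r n)) (v' (r n))) \<longlonglongrightarrow> 0"
      using LIMSEQ_subseq_LIMSEQ[OF d(3) r] by (simp add: o_def)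
    obtain x' r' where x': "x' \<in> X" and r': "strict_mono (r' :: nat \<Rightarrow> nat)" and
      ux': "((\<lambda>n. u' (r n)) \<circ> r') \<longlonglongrightarrow> x'" and
      lim': "(\<lambda>n. dist (f (u' (r (r' n)))) (f (v' (r (r' n)))) / dist (u' (r (r' n))) (v' (r (r' n))))
         \<longlonglongrightarrow> inf_deriv X f x'"
      by (rule ratio_subseq_limit[OF X lip sim uv(3,4) ne(2) d3])
    have ux2: "(\<lambda>n. u (r (r' n))) \<longlonglongrightarrow> x"
      using LIMSEQ_subseq_LIMSEQ[OF ux r'] by (simp add: o_def)
    have d2: "(\<lambda>n. dist (u (r (r' n))) (u' (r (r' n)))) \<longlonglongrightarrow> 0"
      using LIMSEQ_subseq_LIMSEQ[OF LIMSEQ_subseq_LIMSEQ[OF d(2) r] r'] by (simp add: o_def)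
    have "(\<lambda>n. dist (u (r (r' n))) (u' (r (r' n)))) \<longlonglongrightarrow> dist x x'"
      using tendsto_dist[OF ux2] ux' by (simp add: o_def)
    with d2 have "dist x x' = 0" using LIMSEQ_unique by blast
    then have xx: "x' = x" by simp
    have lim2: "(\<lambda>n. dist (f (u (r (r' n)))) (f (v (r (r' n)))) / dist (u (r (r' n))) (v (r (r' n))))
         \<longlonglongrightarrow> inf_deriv X f x"
      using LIMSEQ_subseq_LIMSEQ[OF lim r'] by (simp add: o_def)
    have "q * (dist (f (u n)) (f (v n)) / dist (u n) (v n)) \<le> dist (f (u' n)) (f (v' n)) / dist (u' n) (v' n)" for n
      using uv(8)[of n] ne[of n] by (simp add: field_simps)
    then have "q * inf_deriv X f x \<le> inf_deriv X f x"
      using LIMSEQ_le[OF tendsto_mult[OF tendsto_const lim2] lim'] xx by blast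
    with pos[OF x] q show False by simp
  qed
  then obtain \<rho> where \<rho>: "\<rho> > 0" "?P \<rho>" by blast
  show ?thesis
    unfolding eventually_at_right_field
  proof (intro exI[of _ \<rho>] conjI allI impI)
    fix \<rho>' assume "0 < \<rho>'" "\<rho>' < \<rho>"
    then show "?P \<rho>'" using \<rho>(2) by (meson less_imp_le order_trans)
  qed (use \<rho> in auto)
qed

section \<open>Compositions of the maps\<close>

primrec word_map :: "('i \<Rightarrow> 'a \<Rightarrow> 'a) \<Rightarrow> 'i list \<Rightarrow> 'a \<Rightarrow> 'a" where
  "word_map f [] = id"
| "word_map f (i # w) = f i \<circ> word_map f w"

lemma word_map_append: "word_map f (v @ w) = word_map f v \<circ> word_map f w"
  by (induction v) (auto simp: o_assoc)

lemma word_map_closed: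
  assumes "\<And>i. i \<in> I \<Longrightarrow> f i ` A \<subseteq> A" "set w \<subseteq> I" "x \<in> A"
  shows "word_map f w x \<in> A"
  using assms(2) by (induction w) (use assms(1,3) in auto)

lemma word_map_cover:
  assumes "A = (\<Union>i\<in>I. f i ` A)" "x \<in> A"
  shows "\<exists>w. length w = n \<and> set w \<subseteq> I \<and> x \<in> word_map f w ` A"
  using assms(2)
proof (induction n arbitrary: x)
  case (Suc n)
  then obtain i y where y: "i \<in> I" "y \<in> A" "x = f i y" using assms(1) by blast
  with Suc.IH obtain w where "length w = n" "set w \<subseteq> I" "y \<in> word_map f w ` A" by blast
  then show ?case using y by (intro exI[of _ "i # w"]) auto
qed auto

lemma word_map_upper:
  fixes f :: "'i \<Rightarrow> 'a::metric_space \<Rightarrow> 'a"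
  assumes cl: "\<And>i. i \<in> I \<Longrightarrow> f i ` A \<subseteq> A"
    and lip: "\<And>i x y. i \<in> I \<Longrightarrow> x \<in> A \<Longrightarrow> y \<in> A \<Longrightarrow> dist (f i x) (f i y) \<le> c * dist x y"
    and "0 \<le> c" "set w \<subseteq> I" "x \<in> A" "y \<in> A"
  shows "dist (word_map f w x) (word_map f w y) \<le> c ^ length w * dist x y"
  using assms(4)
proof (induction w)
  case (Cons i w)
  then have "dist (word_map f (i # w) x) (word_map f (i # w) y)
      \<le> c * dist (word_map f w x) (word_map f w y)"
    using lip[of i] word_map_closed[where I = I and f = f and A = A, OF cl] assms by auto
  also have "\<dots> \<le> c * (c ^ length w * dist x y)"
    using Cons \<open>0 \<le> c\<close> by (intro mult_left_mono) auto
  finally show ?case by (simp add: mult_ac)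
qed simp

text \<open>The maps do not expand distances, so a pair within \<open>R\<close> stays within
  \<open>R\<close> and the local bound \<open>low\<close> applies at every letter.\<close>

lemma word_map_lower:
  fixes f :: "'i \<Rightarrow> 'a::metric_space \<Rightarrow> 'a"
  assumes cl: "\<And>i. i \<in> I \<Longrightarrow> f i ` A \<subseteq> A"
    and lip: "\<And>i x y. i \<in> I \<Longrightarrow> x \<in> A \<Longrightarrow> y \<in> A \<Longrightarrow> dist (f i x) (f i y) \<le> dist x y"
    and low: "\<And>i x y. i \<in> I \<Longrightarrow> x \<in> A \<Longrightarrow> y \<in> A \<Longrightarrow> dist x y \<le> R \<Longrightarrow> l * dist x y \<le> dist (f i x) (f i y)"
    and "0 \<le> l" "set w \<subseteq> I" "x \<in> A" "y \<in> A" "dist x y \<le> R"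
  shows "l ^ length w * dist x y \<le> dist (word_map f w x) (word_map f w y)"
  using assms(5)
proof (induction w)
  case (Cons i w)
  have "dist (word_map f w x) (word_map f w y) \<le> 1 ^ length w * dist x y"
    by (rule word_map_upper[where I = I]) (use assms Cons in auto)
  then have R: "dist (word_map f w x) (word_map f w y) \<le> R" using assms by simp
  have "l ^ length (i # w) * dist x y = l * (l ^ length w * dist x y)" by simp
  also have "\<dots> \<le> l * dist (word_map f w x) (word_map f w y)"
    using Cons \<open>0 \<le> l\<close> by (intro mult_left_mono) auto
  also have "\<dots> \<le> dist (word_map f (i # w) x) (word_map f (i # w) y)"
    using low[of i "word_map f w x" "word_map f w y"] Cons R
      word_map_closed[where I = I and f = f and A = A, OF cl] assms by auto
  finally show ?case .
qed simp

text \<open>The innermost \<open>K\<close> maps cost at most a factor \<open>l ^ K\<close>; after them all points are within \<open>\<rho>\<close> of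
  each other, and every further map costs at most a factor \<open>q\<close>.\<close>

lemma word_map_distortion:
  fixes f :: "'i \<Rightarrow> 'a::metric_space \<Rightarrow> 'a"
  assumes cl: "\<And>i. i \<in> I \<Longrightarrow> f i ` A \<subseteq> A"
    and lip: "\<And>i x y. i \<in> I \<Longrightarrow> x \<in> A \<Longrightarrow> y \<in> A \<Longrightarrow> dist (f i x) (f i y) \<le> c * dist x y"
    and c: "0 \<le> c" "c \<le> 1"
    and low: "\<And>i x y. i \<in> I \<Longrightarrow> x \<in> A \<Longrightarrow> y \<in> A \<Longrightarrow> dist x y \<le> R \<Longrightarrow> l * dist x y \<le> dist (f i x) (f i y)"
    and l: "0 < l" "l \<le> 1"
    and cmp: "\<And>i u v u' v'. i \<in> I \<Longrightarrow> u \<in> A \<Longrightarrow> v \<in> A \<Longrightarrow> u' \<in> A \<Longrightarrow> v' \<in> A \<Longrightarrow>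
      dist u v \<le> \<rho> \<Longrightarrow> dist u u' \<le> \<rho> \<Longrightarrow> dist u' v' \<le> \<rho> \<Longrightarrow>
      dist (f i u') (f i v') * dist u v \<le> q * (dist (f i u) (f i v) * dist u' v')"
    and q: "1 \<le> q"
    and diam: "\<And>x y. x \<in> A \<Longrightarrow> y \<in> A \<Longrightarrow> dist x y \<le> d" and K: "c ^ K * d \<le> \<rho>"
    and uv: "u \<in> A" "v \<in> A" "dist u v \<le> R" "u' \<in> A" "v' \<in> A"
    and w: "set w \<subseteq> I"
  shows "l ^ K * (dist (word_map f w u') (word_map f w v') * dist u v)
      \<le> q ^ length w * (dist (word_map f w u) (word_map f w v) * dist u' v')"
proof -
  have lip1: "dist (f i x) (f i y) \<le> dist x y" if "i \<in> I" "x \<in> A" "y \<in> A" for i x y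
    using lip[OF that] c mult_right_mono[of c 1 "dist x y"] by simp
  show ?thesis using w
  proof (induction w)
    case Nil
    show ?case using l by (simp add: mult_ac mult_left_le_one_le power_le_one)
  next
    case (Cons i w)
    define a b a' b' where ab: "a = word_map f w u" "b = word_map f w v"
      "a' = word_map f w u'" "b' = word_map f w v'"
    have i: "i \<in> I" and w: "set w \<subseteq> I" using Cons.prems by auto
    have inA: "a \<in> A" "b \<in> A" "a' \<in> A" "b' \<in> A"
      unfolding ab by (rule word_map_closed[where I = I and f = f, OF cl w]; use uv in simp)+
    show ?case
    proof (cases "length w < K")
      case True
      \<comment> \<open>With at most \<open>K\<close> letters crude bounds suffice: non-expansion
        for the pair \<open>u'\<close>, \<open>v'\<close>, the local lower bound for
        \<open>u\<close>, \<open>v\<close>, and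
        \<open>l ^ K \<le> l ^ length (i # w)\<close>.\<close>
      have "l ^ K * (dist (f i a') (f i b') * dist u v)
        \<le> l ^ length (i # w) * (dist u' v' * dist u v)"
      proof (intro mult_mono power_decreasing)
        have "dist (f i a') (f i b') \<le> 1 ^ length (i # w) * dist u' v'"
          using word_map_upper[of I f A 1 "i # w" u' v'] cl lip1 i w uv unfolding ab by auto
        then show "dist (f i a') (f i b') \<le> dist u' v'" by simp
      qed (use True l in auto)
      also have "\<dots> = (l ^ length (i # w) * dist u v) * dist u' v'" by simp
      also have "\<dots> \<le> dist (f i a) (f i b) * dist u' v'"
        using word_map_lower[of I f A R l "i # w" u v] cl lip1 low i w uv l unfolding ab
        by (intro mult_right_mono) auto
      also have "\<dots> \<le> q ^ length (i # w) * (dist (f i a) (f i b) * dist u' v')"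
        using mult_right_mono[OF one_le_power[OF q, of "length (i # w)"], of "dist (f i a) (f i b) * dist u' v'"]
        by simp
      finally show ?thesis by (simp add: ab)
    next
      case False
      \<comment> \<open>At least \<open>K\<close> maps have already acted, so all images are within
        \<open>\<rho>\<close> of each other and \<open>cmp\<close> applies to the outer
        letter.\<close>
      have small: "dist (word_map f w x) (word_map f w y) \<le> \<rho>" if "x \<in> A" "y \<in> A" for x y
      proof -
        have "dist (word_map f w x) (word_map f w y) \<le> c ^ length w * dist x y"
          by (rule word_map_upper[OF cl lip c(1) w that])
        also have "\<dots> \<le> c ^ K * d"
          using False c diam that by (intro mult_mono power_decreasing) auto
        finally show ?thesis using K by simp
      qed
      have C: "dist (f i a') (f i b') * dist a b \<le> q * (dist (f i a) (f i b) * dist a' b')"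
        by (rule cmp[OF i inA]) (use small uv in \<open>auto simp: ab\<close>)
      have IH: "l ^ K * (dist a' b' * dist u v) \<le> q ^ length w * (dist a b * dist u' v')"
        using Cons.IH w by (simp add: ab)
      \<comment> \<open>The factor \<open>dist a b\<close> has to be cancelled when \<open>C\<close>
        and \<open>IH\<close> are combined. If it is 0, the lower bound forces
        \<open>dist u v = 0\<close> and the claim is trivial.\<close>
      show ?thesis
      proof (cases "dist a b = 0")
        case True
        have "l ^ length w * dist u v \<le> dist a b"
          unfolding ab by (rule word_map_lower[OF cl lip1 low _ w]) (use uv l in auto)
        then have "dist u v = 0" using True l
          by (metis (no_types) mult_le_cancel_left_pos mult_zero_right zero_le_dist order_antisym zero_less_power)
        then show ?thesis using q by simp
      next
        case False
        then have pos: "dist a b > 0" by simp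
        have "l ^ K * (dist (f i a') (f i b') * dist u v) * dist a b
          = l ^ K * dist u v * (dist (f i a') (f i b') * dist a b)" by simp
        also have "\<dots> \<le> l ^ K * dist u v * (q * (dist (f i a) (f i b) * dist a' b'))"
          using C l by (intro mult_left_mono) auto
        also have "\<dots> = q * dist (f i a) (f i b) * (l ^ K * (dist a' b' * dist u v))" by simp
        also have "\<dots> \<le> q * dist (f i a) (f i b) * (q ^ length w * (dist a b * dist u' v'))"
          using IH q by (intro mult_left_mono) auto
        also have "\<dots> = q ^ length (i # w) * (dist (f i a) (f i b) * dist u' v') * dist a b" by simp
        finally show ?thesis using pos by (simp add: ab)
      qed
    qed
  qed
qed

text \<open>The lower Lipschitz bound is only required at scale at most \<open>R\<close>, because maps with
  positive infinitesimal similarity ratios need not be injective. The loss \<open>r powr \<epsilon>\<close> compensates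
  for the lack of bounded distortion: the ratios need only be continuous.\<close>

definition has_small_copies :: "'a::metric_space set \<Rightarrow> real \<Rightarrow> bool" where
  "has_small_copies A R \<longleftrightarrow> (\<forall>\<epsilon>>0. \<exists>a>0. \<forall>x\<in>A. \<forall>r. 0 < r \<and> r \<le> 1 \<longrightarrow>
      (\<exists>g. g ` A \<subseteq> A \<inter> cball x r \<and>
        (\<forall>u\<in>A. \<forall>v\<in>A. dist u v \<le> R \<longrightarrow> a * r powr (1 + \<epsilon>) * dist u v \<le> dist (g u) (g v))))"

text \<open>The copy is \<open>word_map f w\<close> for a word stopped once its image around
  \<open>x\<close> has diameter at most \<open>r\<close>. Unless \<open>w\<close> is empty, its
  parent \<open>w'\<close> still has two image points more than \<open>r\<close> apart, and
  distortion transfers this to all pairs within \<open>R\<close>. The loss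
  \<open>q ^ length w'\<close> is at most a constant times \<open>r powr (- \<epsilon>)\<close>,
  because an image larger than \<open>r\<close> limits the length of \<open>w'\<close>.\<close>

lemma attractor_small_copies:
  fixes A X :: "'a::metric_space set" and f :: "nat \<Rightarrow> 'a \<Rightarrow> 'a"
  assumes X: "compact X"
    and contr: "\<forall>i\<in>{1..N}. contraction_on X (f i)"
    and sim: "\<forall>i\<in>{1..N}. inf_similitude_on X (f i)"
    and pos: "\<forall>i\<in>{1..N}. \<forall>x\<in>X. 0 < inf_deriv X (f i) x"
    and attr: "is_attractor X N f A"
  obtains R where "0 < R"
    "has_small_copies A R"
proof -
  let ?I = "{1..N}"
  have AX: "A \<subseteq> X" and cA: "compact A" and AU: "A = (\<Union>i\<in>?I. f i ` A)"
    using attr by (auto simp: is_attractor_def)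
  have cl: "f i ` A \<subseteq> A" if "i \<in> ?I" for i using AU that by blast
  have "\<forall>\<^sub>F c in at_left 1. \<forall>x\<in>X. \<forall>y\<in>X. dist (f i x) (f i y) \<le> c * dist x y" if i: "i \<in> ?I" for i
  proof -
    \<comment> \<open>Each map has its own constant, possibly not positive. Larger constants work as
      well, so those close to 1 serve all maps at once.\<close>
    obtain c where c: "c < 1" "\<forall>x\<in>X. \<forall>y\<in>X. dist (f i x) (f i y) \<le> c * dist x y"
      using contr[rule_format, OF i] unfolding contraction_on_def by blast
    have "\<forall>\<^sub>F c' in at_left 1. c < c'" using c(1) by (simp add: eventually_at_left_field) blast
    then show ?thesis
      by eventually_elim (use c(2) in \<open>meson less_imp_le mult_right_mono order_trans zero_le_dist\<close>)
  qed
  then have "\<forall>\<^sub>F c in at_left 1. \<forall>i\<in>?I. \<forall>x\<in>X. \<forall>y\<in>X. dist (f i x) (f i y) \<le> c * dist x y"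
    by (simp add: eventually_ball_finite)
  moreover have "\<forall>\<^sub>F c in at_left (1::real). c < 1 \<and> 0 < c"
    by (auto simp: eventually_at_left_field intro!: exI[of _ 0])
  ultimately obtain c where c: "0 < c" "c < 1"
    and lipX: "\<And>i x y. i \<in> ?I \<Longrightarrow> x \<in> X \<Longrightarrow> y \<in> X \<Longrightarrow> dist (f i x) (f i y) \<le> c * dist x y"
    using eventually_happens'[OF trivial_limit_at_left_real eventually_conj] by blast
  have lip: "dist (f i x) (f i y) \<le> c * dist x y" if "i \<in> ?I" "x \<in> A" "y \<in> A" for i x y
    using lipX[OF that(1)] that AX by blast
  have "\<forall>\<^sub>F \<rho> in at_right 0. \<forall>u\<in>X. \<forall>v\<in>X. dist u v \<le> \<rho> \<longrightarrow> \<rho> * dist u v \<le> dist (f i u) (f i v)"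
    if i: "i \<in> ?I" for i
    by (rule local_lower_bound[OF X lipX[OF i]]) (use sim pos i in auto)
  then have "\<forall>\<^sub>F \<rho> in at_right 0. \<forall>i\<in>?I. \<forall>u\<in>X. \<forall>v\<in>X. dist u v \<le> \<rho> \<longrightarrow> \<rho> * dist u v \<le> dist (f i u) (f i v)"
    by (simp add: eventually_ball_finite)
  moreover have "\<forall>\<^sub>F \<rho> in at_right (0::real). 0 < \<rho> \<and> \<rho> < 1"
    by (auto simp: eventually_at_right_field intro!: exI[of _ 1])
  ultimately obtain R where R: "0 < R" "R < 1"
    and lowX: "\<And>i u v. i \<in> ?I \<Longrightarrow> u \<in> X \<Longrightarrow> v \<in> X \<Longrightarrow> dist u v \<le> R \<Longrightarrow> R * dist u v \<le> dist (f i u) (f i v)"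
    using eventually_happens'[OF trivial_limit_at_right_real eventually_conj] by blast
  have low: "R * dist u v \<le> dist (f i u) (f i v)" if "i \<in> ?I" "u \<in> A" "v \<in> A" "dist u v \<le> R" for i u v
    using lowX[OF that(1)] that AX by blast
  \<comment> \<open>Taking \<open>1 \<le> d\<close> yields \<open>a \<le> 1\<close> below, which
    settles the empty word.\<close>
  obtain d where d: "1 \<le> d" and diam: "\<And>x y. x \<in> A \<Longrightarrow> y \<in> A \<Longrightarrow> dist x y \<le> d"
    using diameter_bounded_bound[OF compact_imp_bounded[OF cA]] by (metis le_max_iff_disj max.cobounded1)
  show thesis
  proof (rule that[OF \<open>0 < R\<close>], unfold has_small_copies_def, intro allI impI)
    fix \<epsilon> :: real assume \<epsilon>: "0 < \<epsilon>"
    \<comment> \<open>With this \<open>q\<close>, the loss \<open>q ^ n\<close> along a word of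
      length \<open>n\<close> equals \<open>(c ^ n) powr (- \<epsilon>)\<close>.\<close>
    define q where "q = c powr (-\<epsilon>)"
    have q: "1 < q" using c \<epsilon> by (simp add: q_def powr_minus one_less_inverse_iff powr01_less_one)
    have "\<forall>\<^sub>F \<rho> in at_right 0. \<forall>u\<in>X. \<forall>v\<in>X. \<forall>u'\<in>X. \<forall>v'\<in>X.
      dist u v \<le> \<rho> \<and> dist u u' \<le> \<rho> \<and> dist u' v' \<le> \<rho> \<longrightarrow>
      dist (f i u') (f i v') * dist u v \<le> q * (dist (f i u) (f i v) * dist u' v')"
      if i: "i \<in> ?I" for i
      by (rule local_ratio_comparison[OF X lipX[OF i] _ _ q]) (use sim pos i in auto)
    then have "\<forall>\<^sub>F \<rho> in at_right 0. \<forall>i\<in>?I. \<forall>u\<in>X. \<forall>v\<in>X. \<forall>u'\<in>X. \<forall>v'\<in>X.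
      dist u v \<le> \<rho> \<and> dist u u' \<le> \<rho> \<and> dist u' v' \<le> \<rho> \<longrightarrow>
      dist (f i u') (f i v') * dist u v \<le> q * (dist (f i u) (f i v) * dist u' v')"
      by (simp add: eventually_ball_finite)
    moreover have "\<forall>\<^sub>F \<rho> in at_right (0::real). 0 < \<rho>" by (rule eventually_at_right_less)
    ultimately obtain \<rho> where \<rho>: "0 < \<rho>"
      and cmpX: "\<forall>i\<in>?I. \<forall>u\<in>X. \<forall>v\<in>X. \<forall>u'\<in>X. \<forall>v'\<in>X.
      dist u v \<le> \<rho> \<and> dist u u' \<le> \<rho> \<and> dist u' v' \<le> \<rho> \<longrightarrow>
      dist (f i u') (f i v') * dist u v \<le> q * (dist (f i u) (f i v) * dist u' v')"
      using eventually_happens'[OF trivial_limit_at_right_real eventually_conj] by blast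
    have cmp: "dist (f i u') (f i v') * dist u v \<le> q * (dist (f i u) (f i v) * dist u' v')"
      if "i \<in> ?I" "u \<in> A" "v \<in> A" "u' \<in> A" "v' \<in> A" "dist u v \<le> \<rho>" "dist u u' \<le> \<rho>" "dist u' v' \<le> \<rho>"
      for i u v u' v'
      using cmpX that AX by blast
    have small: "\<exists>n. c ^ n * d \<le> e" if "e > 0" for e :: real
      using real_arch_pow_inv[of "e / d" c] that c d by (auto simp: pos_less_divide_eq intro: less_imp_le)
    obtain K where K: "c ^ K * d \<le> \<rho>" using small[OF \<rho>] by blast
    \<comment> \<open>\<open>R ^ K\<close> comes from distortion, the further \<open>R\<close> from
      the innermost letter, one factor \<open>d\<close> from \<open>dist u' v' \<le> d\<close>, and
      \<open>d powr \<epsilon>\<close> from the bound on the word length.\<close>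
    define a where "a = R ^ K * R / (d powr (1 + \<epsilon>))"
    have a: "0 < a" using R d by (simp add: a_def)
    have a1: "a \<le> 1"
    proof -
      have "R ^ K * R \<le> 1" using R power_le_one[of R "Suc K"] by (simp add: mult.commute)
      also have "\<dots> \<le> d powr (1 + \<epsilon>)" using d \<epsilon> by (simp add: ge_one_powr_ge_zero)
      finally show ?thesis using d by (simp add: a_def)
    qed
    have copy: "\<exists>g. g ` A \<subseteq> A \<inter> cball x r \<and>
        (\<forall>u\<in>A. \<forall>v\<in>A. dist u v \<le> R \<longrightarrow> a * r powr (1 + \<epsilon>) * dist u v \<le> dist (g u) (g v))"
      if x: "x \<in> A" and r: "0 < r" "r \<le> 1" for x r
    proof -
      text \<open>For a shortest word whose image contains \<open>x\<close> and has diameter at most \<open>r\<close>, the image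
        of the word without its innermost letter is still larger than \<open>r\<close>.\<close>
      let ?P = "\<lambda>n. \<exists>w. length w = n \<and> set w \<subseteq> ?I \<and> x \<in> word_map f w ` A \<and>
        (\<forall>p\<in>A. \<forall>p'\<in>A. dist (word_map f w p) (word_map f w p') \<le> r)"
      obtain n0 where n0: "c ^ n0 * d \<le> r" using small[OF r(1)] by blast
      obtain w0 where w0: "length w0 = n0" "set w0 \<subseteq> ?I" "x \<in> word_map f w0 ` A"
        using word_map_cover[OF AU x] by blast
      have "dist (word_map f w0 p) (word_map f w0 p') \<le> r" if "p \<in> A" "p' \<in> A" for p p'
      proof -
        have "dist (word_map f w0 p) (word_map f w0 p') \<le> c ^ length w0 * dist p p'"
          by (rule word_map_upper[OF cl lip _ w0(2) that]) (use c in auto)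
        also have "\<dots> \<le> c ^ n0 * d" using diam that c w0 by (simp add: mult_left_mono)
        finally show ?thesis using n0 by simp
      qed
      then have "?P n0" using w0 by blast
      then obtain n where Pn: "?P n" and min: "\<And>m. m < n \<Longrightarrow> \<not> ?P m"
        using exists_least_iff[of ?P] by blast
      obtain w where w: "length w = n" "set w \<subseteq> ?I" "x \<in> word_map f w ` A"
        and wr: "\<And>p p'. p \<in> A \<Longrightarrow> p' \<in> A \<Longrightarrow> dist (word_map f w p) (word_map f w p') \<le> r"
        using Pn by blast
      have img: "word_map f w ` A \<subseteq> A \<inter> cball x r"
        using word_map_closed[where I = ?I and f = f, OF cl w(2)] w(3) wr by auto
      have low': "a * r powr (1 + \<epsilon>) * dist u v \<le> dist (word_map f w u) (word_map f w v)"
        if uv: "u \<in> A" "v \<in> A" "dist u v \<le> R" for u v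
      proof (cases w rule: rev_cases)
        case Nil
        have "a * r powr (1 + \<epsilon>) \<le> 1 * 1"
          using a a1 r \<epsilon> by (intro mult_mono powr_le1) auto
        then have "a * r powr (1 + \<epsilon>) * dist u v \<le> 1 * dist u v"
          by (intro mult_right_mono) auto
        then show ?thesis using Nil by simp
      next
        case (snoc w' i)
        have w': "set w' \<subseteq> ?I" "i \<in> ?I" "length w' < n" using w snoc by auto
        have "x \<in> word_map f w' ` A"
          using w(3) cl[OF w'(2)] unfolding snoc word_map_append by auto
        then obtain u' v' where uv': "u' \<in> A" "v' \<in> A"
          and big: "r < dist (word_map f w' u') (word_map f w' v')"
          using min[OF w'(3)] w'(1) unfolding not_le[symmetric] by blast
        have fA: "f i u \<in> A" "f i v \<in> A" using cl[OF w'(2)] uv by auto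
        have fR: "dist (f i u) (f i v) \<le> R"
          using lip[OF w'(2) uv(1,2)] uv(3) c mult_right_mono[of c 1 "dist u v"] by simp
        \<comment> \<open>An image of \<open>w'\<close> wider than \<open>r\<close> bounds
          \<open>c ^ length w'\<close> from below, so that \<open>(r / d) powr \<epsilon>\<close>
          absorbs the distortion \<open>q ^ length w'\<close>.\<close>
        have "dist (word_map f w' u') (word_map f w' v') \<le> c ^ length w' * dist u' v'"
          by (rule word_map_upper[OF cl lip _ w'(1) uv']) (use c in auto)
        also have "\<dots> \<le> c ^ length w' * d" using diam uv' c by (simp add: mult_left_mono)
        finally have "r / d < c ^ length w'" using big d by (simp add: pos_divide_less_eq)
        then have "(r / d) powr \<epsilon> \<le> (c ^ length w') powr \<epsilon>"
          using r d \<epsilon> by (intro powr_mono2) auto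
        also have "\<dots> = inverse (q ^ length w')"
          using c by (simp add: q_def powr_minus power_inverse powr_powr powr_realpow[symmetric] mult.commute)
        finally have qr: "(r / d) powr \<epsilon> * q ^ length w' \<le> 1" using q by (simp add: field_simps)
        \<comment> \<open>The pair \<open>u'\<close>, \<open>v'\<close> with images more than
          \<open>r\<close> apart is the reference; \<open>R\<close> serves as both scale and factor
          of the lower bound.\<close>
        have D: "R ^ K * (dist (word_map f w' u') (word_map f w' v') * dist (f i u) (f i v))
          \<le> q ^ length w' * (dist (word_map f w' (f i u)) (word_map f w' (f i v)) * dist u' v')"
          by (rule word_map_distortion[OF cl lip _ _ low _ _ cmp _ diam K fA fR uv' w'(1)])
            (use c R q in auto)
        define h where "h = dist (word_map f w u) (word_map f w v)"
        have "R ^ K * (r * (R * dist u v))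
            \<le> R ^ K * (dist (word_map f w' u') (word_map f w' v') * dist (f i u) (f i v))"
          using R r big low[OF w'(2) uv] by (intro mult_left_mono mult_mono) auto
        also have "\<dots> \<le> q ^ length w' * (h * d)"
          by (rule order_trans[OF D])
            (use diam[OF uv'] q in \<open>auto intro!: mult_left_mono simp: h_def snoc word_map_append\<close>)
        finally have main: "R ^ K * (r * (R * dist u v)) \<le> q ^ length w' * (h * d)" .
        have "a * r powr (1 + \<epsilon>) * dist u v * d
            = (r / d) powr \<epsilon> * (R ^ K * (r * (R * dist u v)))"
          using r d by (simp add: a_def powr_add powr_divide)
        also have "\<dots> \<le> (r / d) powr \<epsilon> * (q ^ length w' * (h * d))"
          using main by (intro mult_left_mono) auto
        also have "\<dots> \<le> 1 * (h * d)"
          unfolding mult.assoc[symmetric, of _ "q ^ length w'"]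
          using qr d by (intro mult_right_mono) (auto simp: h_def)
        finally show ?thesis using d by (simp add: h_def)
      qed
      show ?thesis using img low' by blast
    qed
    show "\<exists>a>0. \<forall>x\<in>A. \<forall>r. 0 < r \<and> r \<le> 1 \<longrightarrow>
      (\<exists>g. g ` A \<subseteq> A \<inter> cball x r \<and>
        (\<forall>u\<in>A. \<forall>v\<in>A. dist u v \<le> R \<longrightarrow> a * r powr (1 + \<epsilon>) * dist u v \<le> dist (g u) (g v)))"
      using a copy by blast
  qed
qed

section \<open>Lower bounds for Hausdorff measure\<close>

text \<open>The condition \<open>0 \<le> d\<close> takes care of the empty set, whose diameter is
  0.\<close>

lemma diameter_le_metric:
  fixes S :: "'a::metric_space set"
  assumes "0 \<le> d" "\<And>x y. x \<in> S \<Longrightarrow> y \<in> S \<Longrightarrow> dist x y \<le> d"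
  shows "bounded S" "diameter S \<le> d"
  using assms by (auto simp: diameter_def bounded_two_points intro!: cSUP_least)

text \<open>Induction on the number of covering sets: if all of them have diameter below \<open>\<sigma>\<close>, each meets at
  most one \<open>g i ` D\<close>, and the sets meeting \<open>g i ` D\<close> pull back along \<open>g i\<close> to a smaller cover of \<open>D\<close>.\<close>

lemma finite_cover_diameter_sum:
  fixes g :: "'i \<Rightarrow> 'a::metric_space \<Rightarrow> 'a" and U :: "'j \<Rightarrow> 'a set"
  assumes I: "finite I" "2 \<le> card I" and D: "D \<noteq> {}" and c: "0 < c" and \<sigma>: "0 < \<sigma>" and s: "0 < s"
    and moran: "1 \<le> real (card I) * c powr s"
    and cl: "\<And>i. i \<in> I \<Longrightarrow> g i ` D \<subseteq> D"
    and sep: "\<And>i j x y. i \<in> I \<Longrightarrow> j \<in> I \<Longrightarrow> i \<noteq> j \<Longrightarrow> x \<in> D \<Longrightarrow> y \<in> D \<Longrightarrow> \<sigma> \<le> dist (g i x) (g j y)"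
    and low: "\<And>i x y. i \<in> I \<Longrightarrow> x \<in> D \<Longrightarrow> y \<in> D \<Longrightarrow> c * dist x y \<le> dist (g i x) (g i y)"
    and U: "finite J" "\<And>j. j \<in> J \<Longrightarrow> bounded (U j)" "D \<subseteq> (\<Union>j\<in>J. U j)"
  shows "\<sigma> powr s \<le> (\<Sum>j\<in>J. diameter (U j) powr s)"
  using U
proof (induction "card J" arbitrary: J U rule: less_induct)
  case (less J U)
  show ?case
  proof (cases "\<exists>j\<in>J. \<sigma> \<le> diameter (U j)")
    case True
    then obtain j where j: "j \<in> J" "\<sigma> \<le> diameter (U j)" by blast
    have "\<sigma> powr s \<le> diameter (U j) powr s" using j \<sigma> s by (intro powr_mono2) auto
    also have "\<dots> \<le> (\<Sum>j\<in>J. diameter (U j) powr s)"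
      using j less.prems by (intro member_le_sum) auto
    finally show ?thesis .
  next
    case False
    define K where "K i = {j \<in> J. U j \<inter> g i ` D \<noteq> {}}" for i
    have finK: "finite (K i)" for i using less.prems by (simp add: K_def)
    have disj: "K i \<inter> K i' = {}" if "i \<in> I" "i' \<in> I" "i \<noteq> i'" for i i'
    proof (rule ccontr)
      assume "K i \<inter> K i' \<noteq> {}"
      then obtain j x y where j: "j \<in> J" "x \<in> D" "y \<in> D" "g i x \<in> U j" "g i' y \<in> U j"
        by (auto simp: K_def)
      then have "dist (g i x) (g i' y) \<le> diameter (U j)"
        using diameter_bounded_bound less.prems(2) by blast
      with sep[OF that j(2,3)] False j(1) show False by fastforce
    qed
    have ne: "K i \<noteq> {}" if "i \<in> I" for i
    proof -
      obtain x where "x \<in> D" using D by blast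
      then have "g i x \<in> D" using cl[OF that] by blast
      then obtain j where "j \<in> J" "g i x \<in> U j" using less.prems(3) by blast
      with \<open>x \<in> D\<close> show ?thesis by (auto simp: K_def)
    qed
    have part: "c powr s * \<sigma> powr s \<le> (\<Sum>j\<in>K i. diameter (U j) powr s)" if i: "i \<in> I" for i
    proof -
      define V where "V j = {x \<in> D. g i x \<in> U j}" for j
      \<comment> \<open>A second index gives a non-empty \<open>K i'\<close> disjoint from
        \<open>K i\<close>, so \<open>K i\<close> is a proper part of \<open>J\<close> and the
        induction hypothesis applies.\<close>
      have "I \<noteq> {i}" using I by auto
      then obtain i' where i': "i' \<in> I" "i' \<noteq> i" using i by blast
      have "K i \<subseteq> J" "K i' \<subseteq> J" by (auto simp: K_def)
      then have "K i \<subset> J" using ne[OF i'(1)] disj[OF i i'(1)] i'(2) by blast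
      then have card: "card (K i) < card J" using less.prems(1) by (simp add: psubset_card_mono)
      have V: "bounded (V j)" "diameter (V j) \<le> diameter (U j) / c" if "j \<in> K i" for j
      proof -
        have b: "bounded (U j)" using that less.prems(2) by (simp add: K_def)
        have "dist x y \<le> diameter (U j) / c" if "x \<in> V j" "y \<in> V j" for x y
        proof -
          have "c * dist x y \<le> dist (g i x) (g i y)" using low[OF i] that by (simp add: V_def)
          also have "\<dots> \<le> diameter (U j)"
            using diameter_bounded_bound[OF b] that by (simp add: V_def)
          finally show ?thesis using c by (simp add: pos_le_divide_eq mult.commute)
        qed
        then show "bounded (V j)" "diameter (V j) \<le> diameter (U j) / c"
          using diameter_le_metric[of "diameter (U j) / c" "V j"] diameter_ge_0[OF b] c by auto
      qed
      have cover: "D \<subseteq> (\<Union>j\<in>K i. V j)"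
      proof
        fix x assume x: "x \<in> D"
        then have "g i x \<in> D" using cl[OF i] by blast
        then obtain j where "j \<in> J" "g i x \<in> U j" using less.prems(3) by blast
        with x show "x \<in> (\<Union>j\<in>K i. V j)" by (auto simp: K_def V_def)
      qed
      have "\<sigma> powr s \<le> (\<Sum>j\<in>K i. diameter (V j) powr s)"
        by (rule less.hyps[OF card finK V(1) cover])
      also have "\<dots> \<le> (\<Sum>j\<in>K i. (diameter (U j) / c) powr s)"
        using V s diameter_ge_0 by (intro sum_mono powr_mono2) auto
      also have "\<dots> = (\<Sum>j\<in>K i. diameter (U j) powr s) / c powr s"
        using less.prems(2) diameter_ge_0 c
        by (auto simp: sum_divide_distrib K_def intro!: sum.cong powr_divide)
      finally show ?thesis using c by (simp add: pos_le_divide_eq mult.commute)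
    qed
    \<comment> \<open>Moran's inequality: each copy accounts for at least
      \<open>c powr s * \<sigma> powr s\<close>, the families \<open>K i\<close> are disjoint, and
      \<open>card I\<close> such terms restore \<open>\<sigma> powr s\<close>.\<close>
    have "\<sigma> powr s \<le> real (card I) * c powr s * \<sigma> powr s"
      using mult_right_mono[OF moran, of "\<sigma> powr s"] by simp
    also have "\<dots> = (\<Sum>i\<in>I. c powr s * \<sigma> powr s)" by simp
    also have "\<dots> \<le> (\<Sum>i\<in>I. \<Sum>j\<in>K i. diameter (U j) powr s)"
      by (intro sum_mono part)
    also have "\<dots> = (\<Sum>j\<in>(\<Union>i\<in>I. K i). diameter (U j) powr s)"
      using I finK disj by (intro sum.UNION_disjoint[symmetric]) auto
    also have "\<dots> \<le> (\<Sum>j\<in>J. diameter (U j) powr s)"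
      using less.prems(1) by (intro sum_mono2) (auto simp: K_def)
    finally show ?thesis .
  qed
qed

section \<open>From finite to countable covers\<close>

lemma thicken_diameter:
  fixes U :: "'a::metric_space set"
  assumes b: "bounded U" and s: "0 < s" and e: "0 < e"
  shows "\<exists>V. open V \<and> bounded V \<and> U \<subseteq> V \<and> diameter V powr s \<le> diameter U powr s + e"
proof -
  \<comment> \<open>An \<open>\<eta>\<close>-neighbourhood adds at most \<open>2 * \<eta>\<close> to
    the diameter, and the power is continuous even at diameter 0 since \<open>0 < s\<close>. The
    error is additive because a multiplicative one would leave no room for one-point sets.\<close>
  have "((\<lambda>\<eta>. (diameter U + 2 * \<eta>) powr s) \<longlongrightarrow> (diameter U + 2 * 0) powr s) (at_right 0)"
    using s diameter_ge_0[OF b]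
    by (intro tendsto_powr' tendsto_intros) (auto simp: eventually_at_right_field intro!: exI[of _ 1])
  then have "\<forall>\<^sub>F \<eta> in at_right 0. (diameter U + 2 * \<eta>) powr s < diameter U powr s + e"
    using e by (intro order_tendstoD(2)) auto
  then obtain \<eta> where \<eta>: "0 < \<eta>" "(diameter U + 2 * \<eta>) powr s < diameter U powr s + e"
    using eventually_happens'[OF trivial_limit_at_right_real eventually_conj[OF eventually_at_right_less]]
    by blast
  define V where "V = (\<Union>x\<in>U. ball x \<eta>)"
  have "dist x y \<le> diameter U + 2 * \<eta>" if xy: "x \<in> V" "y \<in> V" for x y
  proof -
    obtain x' y' where *: "x' \<in> U" "y' \<in> U" "dist x' x < \<eta>" "dist y' y < \<eta>"
      using xy unfolding V_def by auto
    have "dist x y \<le> dist x' x + (dist x' y' + dist y' y)"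
      by (meson add_left_mono dist_triangle dist_triangle3 order_trans)
    then show ?thesis using * diameter_bounded_bound[OF b *(1,2)] by linarith
  qed
  then have V: "bounded V" "diameter V \<le> diameter U + 2 * \<eta>"
    using diameter_le_metric[of "diameter U + 2 * \<eta>" V] diameter_ge_0[OF b] \<eta> by auto
  have "diameter V powr s \<le> (diameter U + 2 * \<eta>) powr s"
    using V diameter_ge_0 s by (intro powr_mono2) auto
  moreover have "open V" "U \<subseteq> V" using \<eta> by (auto simp: V_def)
  ultimately show ?thesis using V \<eta> by (intro exI[of _ V]) auto
qed

text \<open>Each set is enlarged to an open one at cost \<open>e / 2 ^ (n + 1)\<close>. Compactness
  then leaves finitely many of them, and the total error is at most the arbitrary
  \<open>e\<close>.\<close>

lemma countable_cover_diameter_sum: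
  fixes D :: "'a::metric_space set" and U :: "nat \<Rightarrow> 'a set"
  assumes D: "compact D" and s: "0 < s"
    and fin: "\<And>J V. finite (J :: nat set) \<Longrightarrow> (\<And>j. j \<in> J \<Longrightarrow> bounded (V j)) \<Longrightarrow> D \<subseteq> (\<Union>j\<in>J. V j) \<Longrightarrow>
      \<kappa> \<le> (\<Sum>j\<in>J. diameter (V j) powr s)"
    and U: "\<And>n. bounded (U n)" "D \<subseteq> (\<Union>n. U n)"
  shows "ennreal \<kappa> \<le> (\<Sum>n. ennreal (diameter (U n) powr s))"
proof (rule ennreal_le_epsilon)
  fix e :: real assume e: "0 < e"
  have "\<exists>V. open V \<and> bounded V \<and> U n \<subseteq> V \<and> diameter V powr s \<le> diameter (U n) powr s + e * (1/2) ^ Suc n" for n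
    using thicken_diameter[OF U(1) s] e by simp
  then obtain V where V: "\<And>n. open (V n)" "\<And>n. bounded (V n)" "\<And>n. U n \<subseteq> V n"
    "\<And>n. diameter (V n) powr s \<le> diameter (U n) powr s + e * (1/2) ^ Suc n" by metis
  have cover: "D \<subseteq> (\<Union>n\<in>UNIV. V n)" using U V(3) by blast
  obtain J where J: "finite J" "D \<subseteq> (\<Union>n\<in>J. V n)"
    by (rule compactE_image[OF D V(1) cover])
  have half: "(\<Sum>n\<in>J. (1/2::real) ^ Suc n) \<le> 1"
    using sum_le_suminf[of "\<lambda>n. (1/2::real) ^ Suc n" J] J power_half_series
    by (simp add: sums_iff)
  have "\<kappa> \<le> (\<Sum>n\<in>J. diameter (V n) powr s)" using fin[OF J(1) V(2) J(2)] .
  also have "\<dots> \<le> (\<Sum>n\<in>J. diameter (U n) powr s + e * (1/2) ^ Suc n)" by (intro sum_mono V)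
  also have "\<dots> = (\<Sum>n\<in>J. diameter (U n) powr s) + e * (\<Sum>n\<in>J. (1/2) ^ Suc n)"
    by (simp only: sum.distrib sum_distrib_left)
  also have "\<dots> \<le> (\<Sum>n\<in>J. diameter (U n) powr s) + e"
    using half e mult_left_mono[OF half, of e] by simp
  finally have "ennreal \<kappa> \<le> ennreal ((\<Sum>n\<in>J. diameter (U n) powr s) + e)" by (rule ennreal_leI)
  also have "\<dots> = (\<Sum>n\<in>J. ennreal (diameter (U n) powr s)) + ennreal e"
    using e by (simp add: sum_nonneg)
  also have "\<dots> \<le> (\<Sum>n. ennreal (diameter (U n) powr s)) + ennreal e"
    using J by (intro add_right_mono sum_le_suminf) auto
  finally show "ennreal \<kappa> \<le> (\<Sum>n. ennreal (diameter (U n) powr s)) + ennreal e" .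
qed

lemma diam_pow_pos: "0 < s \<Longrightarrow> diam_pow s U = diameter U powr s"
  by (simp add: diam_pow_def)

text \<open>The measure is a supremum over scales, so the single scale 1 already bounds it from
  below.\<close>

lemma hausdorff_measure_ge:
  assumes "\<And>U :: nat \<Rightarrow> 'a::metric_space set. (\<And>n. bounded (U n)) \<Longrightarrow> F \<subseteq> (\<Union>n. U n) \<Longrightarrow>
      \<kappa> \<le> (\<Sum>n. ennreal (diam_pow s (U n)))"
  shows "\<kappa> \<le> hausdorff_measure s F"
proof -
  have "\<kappa> \<le> hausdorff_premeasure s 1 F"
    unfolding hausdorff_premeasure_def
    by (rule INF_greatest) (use assms in \<open>auto simp: diam_le_def\<close>)
  also have "\<dots> \<le> hausdorff_measure s F"
    unfolding hausdorff_measure_def by (rule SUP_upper) auto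
  finally show ?thesis .
qed

text \<open>By the convention in \<open>diam_pow\<close>, a non-empty covering set counts 1. This
  excludes the exponent 0, to which the estimates with \<open>powr\<close> do not apply.\<close>

lemma hausdorff_measure_0_nonzero:
  assumes "F \<noteq> {}"
  shows "hausdorff_measure 0 F \<noteq> 0"
proof -
  have "1 \<le> hausdorff_measure 0 F"
  proof (rule hausdorff_measure_ge)
    fix U :: "nat \<Rightarrow> 'a set" assume "F \<subseteq> (\<Union>n. U n)"
    then obtain n where "U n \<noteq> {}" using assms by blast
    then have "1 = (\<Sum>n\<in>{n}. ennreal (diam_pow 0 (U n)))" by (simp add: diam_pow_def)
    also have "\<dots> \<le> (\<Sum>n. ennreal (diam_pow 0 (U n)))" by (intro sum_le_suminf) auto
    finally show "1 \<le> (\<Sum>n. ennreal (diam_pow 0 (U n)))" .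
  qed
  then show ?thesis by auto
qed

section \<open>Box dimensions\<close>

text \<open>For a separated set of maximal size, the closed balls of radius
  \<open>\<delta> / 2\<close> about its points cover \<open>A\<close>, and their diameters are at
  most \<open>\<delta>\<close>.\<close>

lemma separated_set_ge_covering_number:
  fixes A :: "'a::metric_space set"
  assumes A: "compact A" and \<delta>: "0 < \<delta>"
  obtains S where "finite S" "S \<subseteq> A" "\<forall>x\<in>S. \<forall>y\<in>S. x \<noteq> y \<longrightarrow> \<delta> / 2 < dist x y"
    "covering_number \<delta> A \<le> enat (card S)"
proof -
  let ?P = "\<lambda>S. finite S \<and> S \<subseteq> A \<and> (\<forall>x\<in>S. \<forall>y\<in>S. x \<noteq> y \<longrightarrow> \<delta> / 2 < dist x y)"
  \<comment> \<open>Two points of one ball of radius \<open>\<delta> / 4\<close> are less than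
    \<open>\<delta> / 2\<close> apart, so \<open>card Z\<close> bounds the size of every separated
    set and a maximum exists.\<close>
  obtain Z where Z: "finite Z" "A \<subseteq> (\<Union>z\<in>Z. ball z (\<delta> / 4))"
  proof (rule compactE_image[OF A, of A "\<lambda>z. ball z (\<delta> / 4)"])
    show "A \<subseteq> (\<Union>z\<in>A. ball z (\<delta> / 4))" using \<delta> by auto
  qed auto
  have bd: "card S \<le> card Z" if S: "?P S" for S
  proof -
    have "\<forall>x\<in>S. \<exists>z\<in>Z. dist z x < \<delta> / 4" using S Z(2) by fastforce
    then obtain h where h: "\<And>x. x \<in> S \<Longrightarrow> h x \<in> Z \<and> dist (h x) x < \<delta> / 4" by metis
    have "inj_on h S"
    proof (rule inj_onI, rule ccontr)
      fix x y assume xy: "x \<in> S" "y \<in> S" "h x = h y" "x \<noteq> y"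
      then have "\<delta> / 2 < dist x y" using S by blast
      with dist_triangle3[of x y "h x"] h[OF xy(1)] h[OF xy(2)] xy(3) show False by simp
    qed
    then show ?thesis using card_inj_on_le[of h S Z] h Z(1) by blast
  qed
  obtain S where S: "?P S" and max: "\<And>T. ?P T \<Longrightarrow> card T \<le> card S"
    using ex_has_greatest_nat[of ?P "{}" card "Suc (card Z)"] bd by (auto simp: le_imp_less_Suc)
  have cover: "A \<subseteq> (\<Union>x\<in>S. cball x (\<delta> / 2))"
  proof
    fix y assume y: "y \<in> A"
    show "y \<in> (\<Union>x\<in>S. cball x (\<delta> / 2))"
    proof (rule ccontr)
      assume "y \<notin> (\<Union>x\<in>S. cball x (\<delta> / 2))"
      then have far: "\<And>x. x \<in> S \<Longrightarrow> \<delta> / 2 < dist x y" by (auto simp: not_le)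
      then have "y \<notin> S" using \<delta> by fastforce
      moreover have "?P (insert y S)" using S y far by (auto simp: dist_commute)
      then have "card (insert y S) \<le> card S" by (rule max)
      ultimately show False using S by simp
    qed
  qed
  have "covering_number \<delta> A \<le> enat (card ((\<lambda>x. cball x (\<delta> / 2)) ` S))"
    unfolding covering_number_def
  proof (rule INF_lower, intro CollectI conjI ballI)
    fix U assume "U \<in> (\<lambda>x. cball x (\<delta> / 2)) ` S"
    then obtain x where U: "U = cball x (\<delta> / 2)" by blast
    have "dist p p' \<le> \<delta>" if "p \<in> U" "p' \<in> U" for p p'
      using that dist_triangle3[of p p' x] by (simp add: U)
    then show "diam_le U \<delta>" using diameter_le_metric[of \<delta> U] \<delta> by (auto simp: diam_le_def)
  qed (use S cover in auto)
  also have "\<dots> \<le> enat (card S)" using S by (simp add: card_image_le)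
  finally show thesis using that[of S] S by blast
qed

text \<open>A finite separated set bounds the covering number, so the infimum runs over a non-empty
  family and is attained by well-ordering. Positivity of \<open>card C\<close> makes its logarithm
  meaningful.\<close>

lemma covering_number_compact:
  fixes A :: "'a::metric_space set"
  assumes "compact A" "A \<noteq> {}" "0 < \<delta>"
  obtains C where "finite C" "A \<subseteq> \<Union>C" "\<forall>U\<in>C. diam_le U \<delta>"
    "covering_number \<delta> A = enat (card C)" "0 < card C"
proof -
  let ?\<C> = "{C :: 'a set set. finite C \<and> A \<subseteq> \<Union>C \<and> (\<forall>U\<in>C. diam_le U \<delta>)}"
  obtain S :: "'a set" where "covering_number \<delta> A \<le> enat (card S)"
    by (rule separated_set_ge_covering_number[OF assms(1,3)])
  then have "covering_number \<delta> A \<noteq> \<infinity>" using enat_ile by fastforce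
  then have "?\<C> \<noteq> {}"
    by (intro notI) (simp only: covering_number_def image_empty Inf_empty top_enat_def)
  then obtain C\<^sub>0 where "C\<^sub>0 \<in> ?\<C>" by blast
  then have "enat (card C\<^sub>0) \<in> (\<lambda>C. enat (card C)) ` ?\<C>" by (rule imageI)
  then have "covering_number \<delta> A \<in> (\<lambda>C. enat (card C)) ` ?\<C>"
    unfolding covering_number_def by (rule wellorder_InfI)
  then obtain C where C: "C \<in> ?\<C>" "covering_number \<delta> A = enat (card C)" by blast
  then have "C \<noteq> {}" using assms(2) by auto
  then show thesis using that[of C] C by (auto simp: card_gt_0_iff)
qed

text \<open>Multiplication by the positive number \<open>- ln \<delta>\<close> turns comparisons of
  extended reals into inequalities between a count and a power of the scale.\<close>

lemma box_quotient_compare: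
  assumes "0 < \<delta>" "\<delta> < 1" "0 < n"
  shows "ereal t < ln_enat (enat n) / ereal (- ln \<delta>) \<longleftrightarrow> \<delta> powr (- t) < real n"
    and "ln_enat (enat n) / ereal (- ln \<delta>) < ereal t \<longleftrightarrow> real n < \<delta> powr (- t)"
proof -
  have "ln_enat (enat n) / ereal (- ln \<delta>) = ereal (ln n / (- ln \<delta>))"
    using assms by (simp add: ln_enat_def)
  moreover have "t < ln n / (- ln \<delta>) \<longleftrightarrow> ln (\<delta> powr (- t)) < ln (real n)"
    using assms by (subst pos_less_divide_eq) (auto)
  moreover have "ln n / (- ln \<delta>) < t \<longleftrightarrow> ln (real n) < ln (\<delta> powr (- t))"
    using assms by (subst pos_divide_less_eq) (auto)
  ultimately show "ereal t < ln_enat (enat n) / ereal (- ln \<delta>) \<longleftrightarrow> \<delta> powr (- t) < real n"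
    and "ln_enat (enat n) / ereal (- ln \<delta>) < ereal t \<longleftrightarrow> real n < \<delta> powr (- t)"
    using assms by (auto simp del: ln_powr)
qed

section \<open>Comparison of Hausdorff and box dimensions\<close>

lemma eventually_powr_less:
  fixes b e :: real
  assumes "0 < b" "0 < e"
  shows "\<forall>\<^sub>F \<delta> in at_right 0. \<delta> powr b < e"
proof -
  have "((\<lambda>\<delta>::real. \<delta> powr b) \<longlongrightarrow> 0 powr b) (at_right 0)"
    using assms by (intro tendsto_powr' tendsto_intros) (auto simp: eventually_at_right_field intro!: exI[of _ 1])
  then show ?thesis using assms by (intro order_tendstoD(2)) auto
qed

text \<open>For \<open>t\<close> strictly between the lower box dimension and \<open>s\<close>,
  arbitrarily small scales \<open>\<delta>\<close> admit covers by fewer than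
  \<open>\<delta> powr (- t)\<close> sets. Their \<open>s\<close>-sums are at most
  \<open>\<delta> powr (s - t)\<close>, which tends to 0.\<close>

lemma hausdorff_dim_le_lower_box_dim:
  fixes A :: "'a::metric_space set"
  assumes A: "compact A" "A \<noteq> {}"
  shows "hausdorff_dim A \<le> lower_box_dim A"
proof (rule ccontr)
  assume "\<not> ?thesis"
  then have "lower_box_dim A < hausdorff_dim A" by simp
  then obtain s where s: "lower_box_dim A < ereal s" "ereal s < hausdorff_dim A"
    using ereal_dense2 by blast
  obtain t where t: "lower_box_dim A < ereal t" "ereal t < ereal s" using ereal_dense2[OF s(1)] by blast
  have fr: "\<exists>\<^sub>F \<delta> in at_right 0. ln_enat (covering_number \<delta> A) / ereal (- ln \<delta>) < ereal t"
  proof (rule ccontr)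
    assume "\<not> ?thesis"
    then have "ereal t \<le> lower_box_dim A"
      unfolding lower_box_dim_def frequently_def by (intro Liminf_bounded) (simp add: not_less)
    with t(1) show False by simp
  qed
  have cov: "\<exists>\<delta> C. 0 < \<delta> \<and> \<delta> < \<delta>0 \<and> \<delta> < 1 \<and> finite C \<and> A \<subseteq> \<Union>C \<and> (\<forall>U\<in>C. diam_le U \<delta>) \<and>
      0 < card C \<and> real (card C) < \<delta> powr (- t)" if "0 < \<delta>0" for \<delta>0
  proof -
    have "\<forall>\<^sub>F \<delta> in at_right (0::real). 0 < \<delta> \<and> \<delta> < \<delta>0 \<and> \<delta> < 1"
      using that by (auto simp: eventually_at_right_field intro!: exI[of _ "min \<delta>0 1"])
    from frequently_ex[OF frequently_eventually_conj[OF fr this]] obtain \<delta> where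
      \<delta>: "0 < \<delta>" "\<delta> < \<delta>0" "\<delta> < 1" "ln_enat (covering_number \<delta> A) / ereal (- ln \<delta>) < ereal t" by blast
    obtain C :: "'a set set" where C: "finite C" "A \<subseteq> \<Union>C" "\<forall>U\<in>C. diam_le U \<delta>"
      "covering_number \<delta> A = enat (card C)" "0 < card C"
      by (rule covering_number_compact[OF A \<delta>(1)])
    show ?thesis
      using C \<delta> box_quotient_compare(2)[OF \<delta>(1,3) C(5)]
      by (intro exI[of _ \<delta>] exI[of _ C]) auto
  qed
  \<comment> \<open>Some cover with at least one set has fewer than
    \<open>\<delta> powr (- t)\<close> sets, where \<open>\<delta> < 1\<close>; this forces
    \<open>t\<close> to be positive. Then \<open>0 < s\<close>, and \<open>diam_pow s\<close> is the
    plain power.\<close>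
  have "0 < t"
  proof -
    obtain \<delta> and C :: "'a set set" where "0 < \<delta>" "\<delta> < 1" "0 < card C" "real (card C) < \<delta> powr (- t)"
      using cov[of 1] by auto
    then have "1 < \<delta> powr (- t)" by linarith
    then show ?thesis using powr_le1[of "-t" \<delta>] \<open>0 < \<delta>\<close> \<open>\<delta> < 1\<close> by linarith
  qed
  then have s0: "0 < s" using t by simp
  have pre: "hausdorff_premeasure s \<delta>0 A = 0" if \<delta>0: "0 < \<delta>0" for \<delta>0
  proof -
    have le: "hausdorff_premeasure s \<delta>0 A \<le> 0 + ennreal e" if e: "0 < e" for e
    proof -
      have "\<forall>\<^sub>F \<delta> in at_right 0. \<delta> powr (s - t) < e"
        using t e by (intro eventually_powr_less) auto
      then obtain \<delta>1 where \<delta>1: "0 < \<delta>1" "\<And>\<delta>. 0 < \<delta> \<Longrightarrow> \<delta> < \<delta>1 \<Longrightarrow> \<delta> powr (s - t) < e"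
        by (auto simp: eventually_at_right_field)
      obtain \<delta> C where C: "0 < \<delta>" "\<delta> < min \<delta>0 \<delta>1" "finite C" "A \<subseteq> \<Union>C" "\<And>U. U \<in> C \<Longrightarrow> diam_le U \<delta>"
        "real (card C) < \<delta> powr (- t)"
        using cov[of "min \<delta>0 \<delta>1"] \<delta>0 \<delta>1 by auto
      obtain h where h: "bij_betw h {0..<card C} C" using ex_bij_betw_nat_finite[OF C(3)] by blast
      \<comment> \<open>The finite cover becomes a sequence by padding with empty sets, which
        contribute 0.\<close>
      define U where "U n = (if n < card C then h n else {})" for n
      have hC: "h n \<in> C" if "n < card C" for n using h that by (auto simp: bij_betw_def)
      have "h ` {0..<card C} = C" using h by (simp add: bij_betw_def)
      have UC: "A \<subseteq> (\<Union>n. U n)"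
      proof
        fix x assume "x \<in> A"
        then obtain V where "V \<in> h ` {0..<card C}" "x \<in> V"
          using C(4) \<open>h ` {0..<card C} = C\<close> by auto
        then obtain n where "n < card C" "x \<in> h n" by auto
        then show "x \<in> (\<Union>n. U n)" by (auto simp: U_def)
      qed
      have Ud: "diam_le (U n) \<delta>" for n using C(1,5) hC by (auto simp: U_def diam_le_def)
      have "hausdorff_premeasure s \<delta>0 A \<le> (\<Sum>n. ennreal (diam_pow s (U n)))"
        unfolding hausdorff_premeasure_def 
        by (rule INF_lower) (use UC Ud C(2) in \<open>fastforce simp: diam_le_def\<close>)
      also have "\<dots> = (\<Sum>n<card C. ennreal (diam_pow s (U n)))"
        using s0 by (intro suminf_finite) (auto simp: U_def diam_pow_def)
      also have "\<dots> \<le> (\<Sum>n<card C. ennreal (\<delta> powr s))"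
        using Ud s0 diameter_ge_0
        by (intro sum_mono ennreal_leI) (auto simp: diam_pow_pos diam_le_def intro!: powr_mono2)
      also have "\<dots> = ennreal (real (card C) * \<delta> powr s)"
        by (simp add: ennreal_mult ennreal_of_nat_eq_real_of_nat)
      also have "\<dots> \<le> ennreal e"
      proof (rule ennreal_leI)
        have "real (card C) * \<delta> powr s \<le> \<delta> powr (- t) * \<delta> powr s"
          using C(6) by (intro mult_right_mono) auto
        also have "\<dots> = \<delta> powr (s - t)" by (simp add: powr_add[symmetric])
        also have "\<dots> \<le> e" using \<delta>1(2)[of \<delta>] C by simp
        finally show "real (card C) * \<delta> powr s \<le> e" .
      qed
      finally show ?thesis by simp
    qed
    have "hausdorff_premeasure s \<delta>0 A \<le> 0" by (rule ennreal_le_epsilon) (rule le)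
    then show ?thesis by simp
  qed
  have "hausdorff_measure s A = 0"
    unfolding hausdorff_measure_def using pre by (simp add: SUP_eq_iff)
  then have "hausdorff_dim A \<le> ereal s"
    unfolding hausdorff_dim_def using s0 by (intro Inf_lower) auto
  with s(2) show False by simp
qed

text \<open>Number against contraction: about \<open>\<delta> powr (- t)\<close> separated copies
  contract by no more than a constant times \<open>\<delta> powr (1 + \<epsilon>)\<close>. Since
  \<open>(1 + \<epsilon>) * s < t\<close>, the Moran condition for exponent \<open>s\<close> holds
  at a small scale.\<close>

lemma hausdorff_measure_nonzero_if_small_copies:
  fixes A :: "'a::metric_space set"
  assumes A: "compact A" "A \<noteq> {}" and R: "0 < R"
    and copies: "has_small_copies A R"
    and s: "0 < s" "ereal s < upper_box_dim A"
  shows "hausdorff_measure s A \<noteq> 0"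
proof -
  obtain t where t: "s < t" "ereal t < upper_box_dim A" using ereal_dense2[OF s(2)] by auto
  \<comment> \<open>Chosen so that \<open>q = (1 + \<epsilon>) * s\<close> is the midpoint of
    \<open>s\<close> and \<open>t\<close>.\<close>
  define \<epsilon> where "\<epsilon> = (t / s - 1) / 2"
  define q where "q = (1 + \<epsilon>) * s"
  have \<epsilon>: "0 < \<epsilon>" using s t by (simp add: \<epsilon>_def)
  have "q = (s + t) / 2" using s by (simp add: q_def \<epsilon>_def field_simps)
  then have q: "0 < q" "q < t" using s t by auto
  obtain a where a: "0 < a" and copy: "\<forall>x\<in>A. \<forall>r. 0 < r \<and> r \<le> 1 \<longrightarrow>
      (\<exists>g. g ` A \<subseteq> A \<inter> cball x r \<and>
        (\<forall>u\<in>A. \<forall>v\<in>A. dist u v \<le> R \<longrightarrow> a * r powr (1 + \<epsilon>) * dist u v \<le> dist (g u) (g v)))"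
    using copies \<epsilon> unfolding has_small_copies_def by blast
  have ball_cover: "A \<subseteq> (\<Union>z\<in>A. ball z (R / 4))" using R by auto
  obtain Z where Z: "finite Z" "A \<subseteq> (\<Union>z\<in>Z. ball z (R / 4))"
    by (rule compactE_image[OF A(1) open_ball ball_cover])
  define p where "p = real (card Z)"
  have "Z \<noteq> {}" using Z A(2) by auto
  then have p: "0 < p" using Z by (simp add: p_def card_gt_0_iff)
  \<comment> \<open>Collects the constants of the Moran condition: \<open>a powr s\<close> from the
    copies, \<open>(1/8) powr q\<close> from \<open>r = \<delta> / 8\<close>, and
    \<open>1 / p\<close> from the pigeonhole step.\<close>
  define \<kappa> where "\<kappa> = a powr s * (1/8) powr q / p"
  have \<kappa>: "0 < \<kappa>" using a p by (simp add: \<kappa>_def)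
  have fr: "\<exists>\<^sub>F \<delta> in at_right 0. ereal t < ln_enat (covering_number \<delta> A) / ereal (- ln \<delta>)"
  proof (rule ccontr)
    assume "\<not> ?thesis"
    then have "upper_box_dim A \<le> ereal t"
      unfolding upper_box_dim_def frequently_def by (intro Limsup_bounded) (simp add: not_less)
    with t(2) show False by simp
  qed
  have "\<forall>\<^sub>F \<delta> in at_right (0::real). 0 < \<delta> \<and> \<delta> < 1 \<and> \<delta> < R"
    using R by (auto simp: eventually_at_right_field intro!: exI[of _ "min 1 R"])
  moreover have "\<forall>\<^sub>F \<delta> in at_right 0. \<delta> powr (t - q) < \<kappa>"
    using q \<kappa> by (intro eventually_powr_less) auto
  \<comment> \<open>This makes \<open>\<delta> powr (- t)\<close> exceed \<open>p\<close>, so that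
    the chosen ball contains at least two points of \<open>S\<close>.\<close>
  moreover have "\<forall>\<^sub>F \<delta> in at_right 0. \<delta> powr t < 1 / p"
    using s t p by (intro eventually_powr_less) auto
  ultimately have "\<forall>\<^sub>F \<delta> in at_right 0. (0 < \<delta> \<and> \<delta> < 1 \<and> \<delta> < R) \<and> \<delta> powr (t - q) < \<kappa> \<and> \<delta> powr t < 1 / p"
    by eventually_elim blast
  from frequently_ex[OF frequently_eventually_conj[OF fr this]] obtain \<delta> where
    \<delta>: "0 < \<delta>" "\<delta> < 1" "\<delta> < R" "\<delta> powr (t - q) < \<kappa>" "\<delta> powr t < 1 / p"
      "ereal t < ln_enat (covering_number \<delta> A) / ereal (- ln \<delta>)" by blast
  obtain C :: "'a set set" where C: "finite C" "A \<subseteq> \<Union>C" "\<forall>U\<in>C. diam_le U \<delta>"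
    "covering_number \<delta> A = enat (card C)" "0 < card C"
    by (rule covering_number_compact[OF A \<delta>(1)])
  obtain S where S: "finite S" "S \<subseteq> A" "\<forall>x\<in>S. \<forall>y\<in>S. x \<noteq> y \<longrightarrow> \<delta> / 2 < dist x y"
    "covering_number \<delta> A \<le> enat (card S)"
    by (rule separated_set_ge_covering_number[OF A(1) \<delta>(1)])
  have "\<delta> powr (- t) < real (card C)"
    using box_quotient_compare(1)[OF \<delta>(1,2) C(5)] \<delta>(6) C(4) by simp
  also have "\<dots> \<le> real (card S)" using S(4) C(4) by simp
  finally have cS: "\<delta> powr (- t) < real (card S)" .
  \<comment> \<open>Pigeonhole: some ball holds at least the average share
    \<open>card S / p\<close>.\<close>
  have "\<exists>z\<in>Z. real (card S) \<le> p * real (card (S \<inter> cball z (R / 4)))"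
  proof (rule ccontr)
    assume *: "\<not> ?thesis"
    have "S \<subseteq> (\<Union>z\<in>Z. cball z (R / 4))"
      using S(2) Z(2) by (meson UN_mono ball_subset_cball order_refl order_trans)
    then have "S = (\<Union>z\<in>Z. S \<inter> cball z (R / 4))" by blast
    then have "card S \<le> (\<Sum>z\<in>Z. card (S \<inter> cball z (R / 4)))"
      using card_UN_le[OF Z(1), of "\<lambda>z. S \<inter> cball z (R / 4)"] by metis
    then have "real (card S) \<le> (\<Sum>z\<in>Z. real (card (S \<inter> cball z (R / 4))))"
      unfolding of_nat_sum[symmetric] by (rule of_nat_mono)
    also have "\<dots> < (\<Sum>z\<in>Z. real (card S) / p)"
      using * p Z \<open>Z \<noteq> {}\<close> by (intro sum_strict_mono) (auto simp: pos_less_divide_eq mult.commute not_le)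
    also have "\<dots> = real (card S)" using p by (simp add: p_def)
    finally show False by simp
  qed
  then obtain z where z: "real (card S) \<le> p * real (card (S \<inter> cball z (R / 4)))" by blast
  define I where "I = S \<inter> cball z (R / 4)"
  \<comment> \<open>Points of \<open>D\<close> are within \<open>R\<close> of each other, where the
    lower bound holds. The centres in \<open>I\<close> are within \<open>R / 4\<close> of
    \<open>z\<close> and \<open>r \<le> R / 4\<close>, so the copies map \<open>D\<close> into
    itself.\<close>
  define D where "D = A \<inter> cball z (R / 2)"
  \<comment> \<open>Copies within \<open>\<delta> / 8\<close> of centres more than
    \<open>\<delta> / 2\<close> apart stay at least \<open>\<delta> / 4\<close> apart.\<close>
  define r where "r = \<delta> / 8"
  have r: "0 < r" "r \<le> 1" "r \<le> R / 4" using \<delta> by (auto simp: r_def)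
  have "\<forall>x\<in>A. \<exists>g. g ` A \<subseteq> A \<inter> cball x r \<and>
        (\<forall>u\<in>A. \<forall>v\<in>A. dist u v \<le> R \<longrightarrow> a * r powr (1 + \<epsilon>) * dist u v \<le> dist (g u) (g v))"
    using copy r by blast
  then obtain g where g: "\<And>x. x \<in> A \<Longrightarrow> g x ` A \<subseteq> A \<inter> cball x r"
    "\<And>x u v. x \<in> A \<Longrightarrow> u \<in> A \<Longrightarrow> v \<in> A \<Longrightarrow> dist u v \<le> R \<Longrightarrow>
      a * r powr (1 + \<epsilon>) * dist u v \<le> dist (g x u) (g x v)"
    by metis
  have pm: "\<delta> powr (- t) < p * real (card I)" using cS z by (simp add: I_def)
  have "p < \<delta> powr (- t)" using \<delta>(1,5) p by (simp add: powr_minus field_simps)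
  then have "p * 1 < p * real (card I)" using pm by simp
  then have I2: "2 \<le> card I" using p by simp
  then have "I \<noteq> {}" by auto
  then have Dne: "D \<noteq> {}" using S(2) R by (auto simp: I_def D_def)
  have Dd: "dist u v \<le> R" if "u \<in> D" "v \<in> D" for u v
    using that dist_triangle3[of u v z] by (simp add: D_def)
  have moran: "1 \<le> real (card I) * (a * r powr (1 + \<epsilon>)) powr s"
  proof -
    have "1 = \<delta> powr (- t) * (\<delta> powr (t - q) * \<delta> powr q)"
      using \<delta>(1) by (simp add: powr_add[symmetric])
    also have "\<dots> \<le> (p * real (card I)) * (\<kappa> * \<delta> powr q)"
      using pm \<delta>(4) p \<kappa> by (intro mult_mono) auto
    also have "\<dots> = real (card I) * (a powr s * ((1/8) powr q * \<delta> powr q))"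
      using p by (simp add: \<kappa>_def)
    also have "(1/8) powr q * \<delta> powr q = r powr q"
      using \<delta>(1) by (simp add: r_def powr_mult[symmetric])
    also have "a powr s * r powr q = (a * r powr (1 + \<epsilon>)) powr s"
      using a r by (simp add: powr_mult powr_powr q_def)
    finally show ?thesis .
  qed
  have "ennreal ((\<delta> / 4) powr s) \<le> hausdorff_measure s A"
  proof (rule hausdorff_measure_ge)
    fix U :: "nat \<Rightarrow> 'a set" assume U: "\<And>n. bounded (U n)" "A \<subseteq> (\<Union>n. U n)"
    \<comment> \<open>A cover of \<open>A\<close> also covers \<open>D\<close>, so the bound for the
      compact set \<open>D\<close> suffices.\<close>
    have "ennreal ((\<delta> / 4) powr s) \<le> (\<Sum>n. ennreal (diameter (U n) powr s))"
    proof (rule countable_cover_diameter_sum)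
      show "compact D" using A(1) by (simp add: D_def compact_Int_closed)
      show "D \<subseteq> (\<Union>n. U n)" using U(2) by (auto simp: D_def)
      fix J :: "nat set" and V :: "nat \<Rightarrow> 'a set"
      assume J: "finite J" "\<And>j. j \<in> J \<Longrightarrow> bounded (V j)" "D \<subseteq> (\<Union>j\<in>J. V j)"
      show "(\<delta> / 4) powr s \<le> (\<Sum>j\<in>J. diameter (V j) powr s)"
      proof (rule finite_cover_diameter_sum[where g = g and I = I and c = "a * r powr (1 + \<epsilon>)", OF _ I2 Dne _ _ s(1) moran _ _ _ J])
        fix x assume x: "x \<in> I"
        then have xA: "x \<in> A" and xz: "dist z x \<le> R / 4" using S(2) by (auto simp: I_def)
        show "g x ` D \<subseteq> D"
        proof
          fix y assume "y \<in> g x ` D"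
          then have "y \<in> A" "dist x y \<le> r" using g(1)[OF xA] by (auto simp: D_def)
          then show "y \<in> D" using xz r dist_triangle[of z y x] by (simp add: D_def)
        qed
        fix u v assume uv: "u \<in> D" "v \<in> D"
        then show "a * r powr (1 + \<epsilon>) * dist u v \<le> dist (g x u) (g x v)"
          using g(2)[OF xA] Dd by (simp add: D_def)
        fix y assume y: "y \<in> I" "x \<noteq> y"
        then have yA: "y \<in> A" using S(2) by (auto simp: I_def)
        have "dist x (g x u) \<le> r" "dist y (g y v) \<le> r"
          using g(1)[OF xA] g(1)[OF yA] uv by (auto simp: D_def)
        moreover have "\<delta> / 2 < dist x y" using S(3) x y by (simp add: I_def)
        moreover have "dist x y \<le> dist x (g x u) + (dist (g x u) (g y v) + dist y (g y v))"
          by (meson add_left_mono dist_triangle dist_triangle2 order_trans)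
        ultimately show "\<delta> / 4 \<le> dist (g x u) (g y v)" by (simp add: r_def)
      qed (use S(1) a r \<delta>(1) in \<open>auto simp: I_def\<close>)
    qed (use U s in auto)
    then show "ennreal ((\<delta> / 4) powr s) \<le> (\<Sum>n. ennreal (diam_pow s (U n)))"
      using s by (simp add: diam_pow_pos)
  qed
  then show ?thesis using \<delta>(1) by auto
qed

theorem theorem2p19:
  fixes X A :: "'a::metric_space set" and f :: "nat \<Rightarrow> 'a \<Rightarrow> 'a" and N :: nat
  assumes "compact X"
    and perfect: "\<forall>x\<in>X. x islimpt X"
    and "\<forall>i\<in>{1..N}. contraction_on X (f i)"
    and "\<forall>i\<in>{1..N}. inf_similitude_on X (f i)"
    and "\<forall>i\<in>{1..N}. \<forall>x\<in>X. 0 < inf_deriv X (f i) x"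
    and "is_attractor X N f A"
  shows "hausdorff_dim A = lower_box_dim A \<and> lower_box_dim A = upper_box_dim A"
proof -
  have A: "compact A" "A \<noteq> {}" using assms(6) by (auto simp: is_attractor_def)
  obtain R where R: "0 < R"
    and copies: "has_small_copies A R"
    by (rule attractor_small_copies[OF assms(1,3,4,5,6)])
  \<comment> \<open>An exponent with zero measure is positive because \<open>A\<close> is non-empty,
    and then cannot lie below the upper box dimension.\<close>
  have "upper_box_dim A \<le> hausdorff_dim A"
    unfolding hausdorff_dim_def
  proof (rule Inf_greatest)
    fix d assume "d \<in> ereal ` {s. 0 \<le> s \<and> hausdorff_measure s A = 0}"
    then obtain s where s: "d = ereal s" "0 \<le> s" "hausdorff_measure s A = 0" by blast
    have "s \<noteq> 0" using hausdorff_measure_0_nonzero[OF A(2)] s(3) by auto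
    then have "0 < s" using s(2) by simp
    then show "upper_box_dim A \<le> d"
      using hausdorff_measure_nonzero_if_small_copies[OF A R copies] s by (meson not_le)
  qed
  moreover have "lower_box_dim A \<le> upper_box_dim A"
    unfolding lower_box_dim_def upper_box_dim_def by (rule Liminf_le_Limsup) simp
  ultimately show ?thesis
    using hausdorff_dim_le_lower_box_dim[OF A] by auto
qed

end
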